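(* Let $u,v$ be two packed words of the same length $n$. Then: $$P_u\lhd P_v=\sum_{\sigma\in Comp(u)}P_{v\circ\sigma},\qquad P_u\unlhd P_v=\begin{cases}P_{v\circ u}&\text{if }u\in\mathfrak{S}_n,\\ 0&\text{otherwise.}\end{cases}$$
   Context: Fix an arbitrary field $K$. For a preorder $\leq_a$, write $i\sim_a j$ if $i\leq_a j$ and $j\leq_a i$, and $i<_a j$ if $i\leq_a j$ and not $i\sim_a j$. A double quasi-poset is a triple $P=(V(P),\leq_1,\leq_2)$ with $V(P)$ a finite set and $\leq_1,\leq_2$ two preorders on $V(P)$. An isomorphism is a bijection preserving and reflecting both preorders. $\mathcal{H}_{\mathbf{dqp}}$ is the $K$-vector space with basis the set of isomorphism classes of double quasi-posets. For a bijection $f:V(P)\to V(Q)$, $P\times_f Q=(V(P),\leq_1^f,\leq_2)$, where $i\leq_1^f j$ iff $f(i)\leq_1 f(j)$ in $Q$, and $\leq_2$ is the second preorder of $P$. $I_<(P,Q)$ is the set of bijections $f:V(P)\to V(Q)$ such that $i<_1 j\Rightarrow f(i)<_2 f(j)$ for all $i,j$; $I(P,Q)$ is the set of $f\in I_<(P,Q)$ such that moreover $i\leq_1 j\Rightarrow f(i)\leq_2 f(j)$ for all $i,j$. Put $P\lhd Q=\sum_{f\in I_<(P,Q)}P\times_f Q$ and $P\unlhd Q=\sum_{f\in I(P,Q)}P\times_f Q$, extended bilinearly to $\mathcal{H}_{\mathbf{dqp}}$. A packed word of length $n$ is a word $w=w_1\dots w_n$ over the positive integers whose set of letters is $\{1,\dots,r\}$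 for some $r$; it is identified with the surjection $[n]\to[r]$, $i\mapsto w_i$. Permutations in $\mathfrak{S}_n$ are the packed words of length $n$ with $n$ distinct letters. To a packed word $w$ of length $n$ one associates the double quasi-poset $P_w$ with $V(P_w)=\{1,\dots,n\}$, $i\leq_1 j$ iff $w_i\leq w_j$, and $\leq_2$ the usual order on $\{1,\dots,n\}$. $Comp(w)$ is the set of $w$-compatible permutations: $\sigma\in\mathfrak{S}_n$ such that for all $i,j\in\{1,\dots,n\}$, $w_i<w_j\Rightarrow\sigma(i)<\sigma(j)$. *)

theory Defs
  imports Complex_Main "HOL-Library.FuncSet" "HOL-Library.Poly_Mapping"
begin

section \<open>Double quasi-posets\<close>

record 'a dqp =
  verts :: "'a set"
  le1 :: "'a rel"
  le2 :: "'a rel"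

text \<open>By \<^const>\<open>preorder_on\<close>, both relations are contained in the square of the vertex set, so
  quantifiers over related pairs below range over vertices only.\<close>

definition double_quasi_poset :: "'a dqp \<Rightarrow> bool" where
  "double_quasi_poset P \<longleftrightarrow>
     finite (verts P) \<and> preorder_on (verts P) (le1 P) \<and> preorder_on (verts P) (le2 P)"

definition qeq :: "'a rel \<Rightarrow> 'a \<Rightarrow> 'a \<Rightarrow> bool" where
  "qeq r i j \<longleftrightarrow> (i, j) \<in> r \<and> (j, i) \<in> r"

definition qless :: "'a rel \<Rightarrow> 'a \<Rightarrow> 'a \<Rightarrow> bool" where
  "qless r i j \<longleftrightarrow> (i, j) \<in> r \<and> \<not> qeq r i j"

definition dqp_isomorphism :: "('a \<Rightarrow> 'b) \<Rightarrow> 'a dqp \<Rightarrow> 'b dqp \<Rightarrow> bool" where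
  "dqp_isomorphism g P Q \<longleftrightarrow>
     bij_betw g (verts P) (verts Q) \<and>
     (\<forall>i\<in>verts P. \<forall>j\<in>verts P.
        ((i, j) \<in> le1 P \<longleftrightarrow> (g i, g j) \<in> le1 Q) \<and> ((i, j) \<in> le2 P \<longleftrightarrow> (g i, g j) \<in> le2 Q))"

definition dqp_iso :: "'a dqp \<Rightarrow> 'b dqp \<Rightarrow> bool" where
  "dqp_iso P Q \<longleftrightarrow>
     double_quasi_poset P \<and> double_quasi_poset Q \<and> (\<exists>g. dqp_isomorphism g P Q)"

definition twist :: "('a \<Rightarrow> 'b) \<Rightarrow> 'a dqp \<Rightarrow> 'b dqp \<Rightarrow> 'a dqp" where
  "twist f P Q =
     \<lparr>verts = verts P, le1 = {(i, j) \<in> verts P \<times> verts P. (f i, f j) \<in> le1 Q}, le2 = le2 P\<rparr>"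

text \<open>Bijections between vertex sets are taken to be extensional functions, so that each one is
  counted exactly once.\<close>

definition I_less :: "'a dqp \<Rightarrow> 'b dqp \<Rightarrow> ('a \<Rightarrow> 'b) set" where
  "I_less P Q = {f \<in> verts P \<rightarrow>\<^sub>E verts Q. bij_betw f (verts P) (verts Q) \<and>
     (\<forall>i j. qless (le1 P) i j \<longrightarrow> qless (le2 Q) (f i) (f j))}"

definition I_le :: "'a dqp \<Rightarrow> 'b dqp \<Rightarrow> ('a \<Rightarrow> 'b) set" where
  "I_le P Q = {f \<in> I_less P Q. \<forall>i j. (i, j) \<in> le1 P \<longrightarrow> (f i, f j) \<in> le2 Q}"

lemma finite_I_less: "double_quasi_poset P \<Longrightarrow> double_quasi_poset Q \<Longrightarrow> finite (I_less P Q)"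
  by (rule finite_subset[of _ "verts P \<rightarrow>\<^sub>E verts Q"])
    (auto simp: I_less_def double_quasi_poset_def intro!: finite_PiE)

lemma finite_I_le: "double_quasi_poset P \<Longrightarrow> double_quasi_poset Q \<Longrightarrow> finite (I_le P Q)"
  by (rule finite_subset[OF _ finite_I_less]) (auto simp: I_le_def)


section \<open>Isomorphism classes\<close>

lemma dqp_isomorphism_inv:
  assumes "dqp_isomorphism g P Q"
  shows "dqp_isomorphism (inv_into (verts P) g) Q P"
proof -
  have b: "bij_betw g (verts P) (verts Q)"
    using assms by (simp add: dqp_isomorphism_def)
  then have "bij_betw (inv_into (verts P) g) (verts Q) (verts P)"
    by (rule bij_betw_inv_into)
  moreover from this have "inv_into (verts P) g i \<in> verts P" if "i \<in> verts Q" for i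
    using that by (rule bij_betw_apply)
  ultimately show ?thesis
    using assms bij_betw_inv_into_right[OF b] by (simp add: dqp_isomorphism_def)
qed

lemma dqp_isomorphism_comp:
  assumes "dqp_isomorphism g P Q" "dqp_isomorphism h Q R"
  shows "dqp_isomorphism (h \<circ> g) P R"
proof -
  have "g i \<in> verts Q" if "i \<in> verts P" for i
    using that assms(1) by (auto simp: dqp_isomorphism_def dest: bij_betw_apply)
  with assms show ?thesis
    by (auto simp: dqp_isomorphism_def intro: bij_betw_trans)
qed

lemma dqp_iso_refl: "double_quasi_poset P \<Longrightarrow> dqp_iso P P"
  unfolding dqp_iso_def dqp_isomorphism_def by (intro conjI exI[of _ id]) auto

lemma dqp_iso_sym: "dqp_iso P Q \<Longrightarrow> dqp_iso Q P"
  unfolding dqp_iso_def using dqp_isomorphism_inv by blast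

lemma dqp_iso_trans: "dqp_iso P Q \<Longrightarrow> dqp_iso Q R \<Longrightarrow> dqp_iso P R"
  unfolding dqp_iso_def using dqp_isomorphism_comp by blast

text \<open>Every double quasi-poset is isomorphic to one whose vertices are natural numbers, so nothing is
  lost by forming isomorphism classes over \<^typ>\<open>nat\<close>.\<close>

lemma dqp_nat_representative:
  assumes "double_quasi_poset (P :: 'a dqp)"
  shows "\<exists>Q :: nat dqp. dqp_iso P Q"
proof -
  have fin: "finite (verts P)"
    and sub: "le1 P \<subseteq> verts P \<times> verts P" "le2 P \<subseteq> verts P \<times> verts P"
    and pre: "preorder_on (verts P) (le1 P)" "preorder_on (verts P) (le2 P)"
    using assms by (auto simp: double_quasi_poset_def preorder_on_def)
  obtain g :: "'a \<Rightarrow> nat" where inj: "inj_on g (verts P)"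
    using finite_imp_inj_to_nat_seg[OF fin] by blast
  define Q where "Q = \<lparr>verts = g ` verts P, le1 = map_prod g g ` le1 P, le2 = map_prod g g ` le2 P\<rparr>"
  have mem: "(g i, g j) \<in> map_prod g g ` r \<longleftrightarrow> (i, j) \<in> r"
    if "i \<in> verts P" "j \<in> verts P" "r \<subseteq> verts P \<times> verts P" for i j r
  proof
    assume "(g i, g j) \<in> map_prod g g ` r"
    then obtain a b where ab: "(a, b) \<in> r" "g i = g a" "g j = g b"
      by auto
    with that(3) have "a \<in> verts P" "b \<in> verts P"
      by auto
    with ab that(1,2) inj show "(i, j) \<in> r"
      by (simp add: inj_on_eq_iff)
  qed (auto intro: image_eqI)
  have pre': "preorder_on (g ` verts P) (map_prod g g ` r)" if "preorder_on (verts P) r" for r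
  proof -
    have r: "r \<subseteq> verts P \<times> verts P" "refl_on (verts P) r" "trans r"
      using that by (auto simp: preorder_on_def)
    have "trans (map_prod g g ` r)"
    proof (rule transI)
      fix x y z assume "(x, y) \<in> map_prod g g ` r" "(y, z) \<in> map_prod g g ` r"
      then obtain a b c d where "(a, b) \<in> r" "(c, d) \<in> r" "x = g a" "y = g b" "y = g c" "z = g d"
        by auto
      moreover from this have "b = c"
        using r(1) inj by (auto simp: inj_on_def)
      ultimately show "(x, z) \<in> map_prod g g ` r"
        using r(3) by (auto dest: transD intro!: image_eqI[of _ _ "(a, d)"])
    qed
    with r show ?thesis
      by (auto simp: preorder_on_def refl_on_def intro!: image_eqI)
  qed
  have "double_quasi_poset Q"
    using fin pre pre' by (simp add: double_quasi_poset_def Q_def)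
  moreover have "dqp_isomorphism g P Q"
    using inj mem[OF _ _ sub(1)] mem[OF _ _ sub(2)]
    by (simp add: dqp_isomorphism_def Q_def bij_betw_def)
  ultimately show ?thesis
    using assms by (auto simp: dqp_iso_def)
qed

quotient_type dqp_class = "nat dqp" / partial: "dqp_iso :: nat dqp \<Rightarrow> nat dqp \<Rightarrow> bool"
proof (rule part_equivpI)
  have "double_quasi_poset \<lparr>verts = {} :: nat set, le1 = {}, le2 = {}\<rparr>"
    by (simp add: double_quasi_poset_def)
  then show "\<exists>P :: nat dqp. dqp_iso P P"
    using dqp_iso_refl by blast
  show "symp (dqp_iso :: nat dqp \<Rightarrow> _)"
    by (auto intro: sympI dqp_iso_sym)
  show "transp (dqp_iso :: nat dqp \<Rightarrow> _)"
    by (auto intro: transpI dqp_iso_trans)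
qed


section \<open>The vector space spanned by the isomorphism classes\<close>

type_synonym 'k hdqp = "dqp_class \<Rightarrow>\<^sub>0 'k"

definition hdqp_scale :: "'k::field \<Rightarrow> 'k hdqp \<Rightarrow> 'k hdqp" where
  "hdqp_scale c x = Poly_Mapping.map ((*) c) x"

definition dqp_basis :: "nat dqp \<Rightarrow> 'k::field hdqp" where
  "dqp_basis P = Poly_Mapping.single (abs_dqp_class P) 1"

lemma lookup_hdqp_scale [simp]:
  "Poly_Mapping.lookup (hdqp_scale c x) p = c * Poly_Mapping.lookup x p"
  by (simp add: hdqp_scale_def Poly_Mapping.map.rep_eq when_def)

lemma vector_space_hdqp: "vector_space (hdqp_scale :: 'k::field \<Rightarrow> _)"
  by unfold_locales (auto intro!: poly_mapping_eqI simp: lookup_add algebra_simps)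

definition bilinear_extension ::
  "(dqp_class \<Rightarrow> dqp_class \<Rightarrow> 'k::field hdqp) \<Rightarrow> 'k hdqp \<Rightarrow> 'k hdqp \<Rightarrow> 'k hdqp" where
  "bilinear_extension b x y = (\<Sum>p\<in>Poly_Mapping.keys x. \<Sum>q\<in>Poly_Mapping.keys y.
     hdqp_scale (Poly_Mapping.lookup x p * Poly_Mapping.lookup y q) (b p q))"

lemma bilinear_extension_superset:
  assumes "finite A" "Poly_Mapping.keys x \<subseteq> A" "finite B" "Poly_Mapping.keys y \<subseteq> B"
  shows "bilinear_extension b x y = (\<Sum>p\<in>A. \<Sum>q\<in>B.
     hdqp_scale (Poly_Mapping.lookup x p * Poly_Mapping.lookup y q) (b p q))"
proof -
  have z: "hdqp_scale 0 z = (0 :: 'a hdqp)" for z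
    by (rule poly_mapping_eqI) simp
  have "(\<Sum>q\<in>Poly_Mapping.keys y. hdqp_scale (Poly_Mapping.lookup x p * Poly_Mapping.lookup y q) (b p q))
      = (\<Sum>q\<in>B. hdqp_scale (Poly_Mapping.lookup x p * Poly_Mapping.lookup y q) (b p q))" for p
    by (rule sum.mono_neutral_left) (use assms in \<open>auto simp: in_keys_iff z\<close>)
  then show ?thesis
    unfolding bilinear_extension_def
    by (simp, intro sum.mono_neutral_left) (use assms in \<open>auto simp: in_keys_iff z\<close>)
qed

lemma bilinear_extension_linear:
  "Vector_Spaces.linear hdqp_scale hdqp_scale (\<lambda>x. bilinear_extension b x y)"
  "Vector_Spaces.linear hdqp_scale hdqp_scale (\<lambda>y. bilinear_extension b x y)"
proof -
  interpret vector_space "hdqp_scale :: 'a \<Rightarrow> _"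
    by (rule vector_space_hdqp)
  have keys_scale: "Poly_Mapping.keys (hdqp_scale c u) \<subseteq> Poly_Mapping.keys u" for c :: 'a and u
    by (auto simp: in_keys_iff)
  show "Vector_Spaces.linear hdqp_scale hdqp_scale (\<lambda>x. bilinear_extension b x y)"
  proof (intro Vector_Spaces.linear_iff[THEN iffD2] conjI allI vector_space_hdqp)
    fix u v :: "'a hdqp"
    let ?A = "Poly_Mapping.keys u \<union> Poly_Mapping.keys v"
    show "bilinear_extension b (u + v) y = bilinear_extension b u y + bilinear_extension b v y"
      using Poly_Mapping.keys_add[of u v]
      by (simp add: bilinear_extension_superset[of ?A _ "Poly_Mapping.keys y"] lookup_add
          distrib_right scale_left_distrib sum.distrib)
  next
    fix c and u :: "'a hdqp"
    show "bilinear_extension b (hdqp_scale c u) y = hdqp_scale c (bilinear_extension b u y)"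
      using keys_scale[of c u]
      by (simp add: bilinear_extension_superset[of "Poly_Mapping.keys u" _ "Poly_Mapping.keys y"]
          scale_sum_right mult.assoc)
  qed
  show "Vector_Spaces.linear hdqp_scale hdqp_scale (\<lambda>y. bilinear_extension b x y)"
  proof (intro Vector_Spaces.linear_iff[THEN iffD2] conjI allI vector_space_hdqp)
    fix u v :: "'a hdqp"
    let ?B = "Poly_Mapping.keys u \<union> Poly_Mapping.keys v"
    show "bilinear_extension b x (u + v) = bilinear_extension b x u + bilinear_extension b x v"
      using Poly_Mapping.keys_add[of u v]
      by (simp add: bilinear_extension_superset[of "Poly_Mapping.keys x" _ ?B] lookup_add
          distrib_left scale_left_distrib sum.distrib)
  next
    fix c and u :: "'a hdqp"
    show "bilinear_extension b x (hdqp_scale c u) = hdqp_scale c (bilinear_extension b x u)"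
      using keys_scale[of c u]
      by (simp add: bilinear_extension_superset[of "Poly_Mapping.keys x" _ "Poly_Mapping.keys u"]
          scale_sum_right mult.left_commute)
  qed
qed


section \<open>The two products\<close>

lemma double_quasi_poset_twist:
  assumes "double_quasi_poset P" "double_quasi_poset Q" "f ` verts P \<subseteq> verts Q"
  shows "double_quasi_poset (twist f P Q)"
proof -
  have "trans {(i, j) \<in> verts P \<times> verts P. (f i, f j) \<in> le1 Q}"
    using assms(2) by (auto simp: double_quasi_poset_def preorder_on_def intro!: transI dest: transD)
  with assms show ?thesis
    by (auto simp: double_quasi_poset_def twist_def preorder_on_def refl_on_def)
qed

text \<open>Transport of a bijection along isomorphisms \<open>g\<close> of the domain and \<open>h\<close> of the codomain; both
  \<^const>\<open>I_less\<close> and \<^const>\<open>I_le\<close> are stable under it, so the sums defining the products only depend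
  on isomorphism classes.\<close>

definition transport :: "('a \<Rightarrow> 'c) \<Rightarrow> ('b \<Rightarrow> 'd) \<Rightarrow> 'a dqp \<Rightarrow> 'c dqp \<Rightarrow> ('a \<Rightarrow> 'b) \<Rightarrow> 'c \<Rightarrow> 'd" where
  "transport g h P P' f = restrict (h \<circ> f \<circ> inv_into (verts P) g) (verts P')"

lemma
  assumes P: "double_quasi_poset P" and P': "double_quasi_poset P'"
    and Q: "double_quasi_poset Q" and Q': "double_quasi_poset Q'"
    and g: "dqp_isomorphism g P P'" and h: "dqp_isomorphism h Q Q'"
    and f: "f \<in> I_less P Q"
  shows transport_I_less: "transport g h P P' f \<in> I_less P' Q'"
    and transport_I_le: "f \<in> I_le P Q \<Longrightarrow> transport g h P P' f \<in> I_le P' Q'"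
    and transport_twist: "dqp_isomorphism g (twist f P Q) (twist (transport g h P P' f) P' Q')"
proof -
  define k where "k = inv_into (verts P) g"
  have gb: "bij_betw g (verts P) (verts P')" and hb: "bij_betw h (verts Q) (verts Q')"
    and fb: "bij_betw f (verts P) (verts Q)"
    using g h f by (auto simp: dqp_isomorphism_def I_less_def)
  have kiso: "dqp_isomorphism k P' P"
    unfolding k_def by (rule dqp_isomorphism_inv[OF g])
  then have kb: "bij_betw k (verts P') (verts P)"
    by (simp add: dqp_isomorphism_def)
  have t: "transport g h P P' f i = h (f (k i))" if "i \<in> verts P'" for i
    using that by (simp add: transport_def k_def)
  have tb: "bij_betw (transport g h P P' f) (verts P') (verts Q')"
    using bij_betw_trans[OF bij_betw_trans[OF kb fb] hb] t
    by (simp cong: bij_betw_cong)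
  have sub: "le1 P' \<subseteq> verts P' \<times> verts P'" "le2 Q \<subseteq> verts Q \<times> verts Q"
    "le1 P \<subseteq> verts P \<times> verts P"
    using P' Q P by (auto simp: double_quasi_poset_def preorder_on_def)
  have in_P: "k i \<in> verts P" "f (k i) \<in> verts Q" if "i \<in> verts P'" for i
    using that kb fb by (auto dest: bij_betw_apply)
  have kk: "(k i, k j) \<in> le1 P \<longleftrightarrow> (i, j) \<in> le1 P'" if "i \<in> verts P'" "j \<in> verts P'" for i j
    using that kiso by (auto simp: dqp_isomorphism_def)
  have hh1: "(h a, h b) \<in> le1 Q' \<longleftrightarrow> (a, b) \<in> le1 Q"
    and hh2: "(h a, h b) \<in> le2 Q' \<longleftrightarrow> (a, b) \<in> le2 Q" if "a \<in> verts Q" "b \<in> verts Q" for a b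
    using that h by (auto simp: dqp_isomorphism_def)
  have "qless (le2 Q') (transport g h P P' f i) (transport g h P P' f j)"
    if "qless (le1 P') i j" for i j
  proof -
    have ij: "i \<in> verts P'" "j \<in> verts P'"
      using that sub(1) by (auto simp: qless_def)
    then have "qless (le1 P) (k i) (k j)"
      using that by (simp add: qless_def qeq_def kk)
    then have "qless (le2 Q) (f (k i)) (f (k j))"
      using f by (simp add: I_less_def)
    then show ?thesis
      using ij in_P by (simp add: qless_def qeq_def t hh2)
  qed
  then show less: "transport g h P P' f \<in> I_less P' Q'"
    using tb by (auto simp: I_less_def transport_def PiE_def extensional_def dest: bij_betw_apply)
  show "transport g h P P' f \<in> I_le P' Q'" if "f \<in> I_le P Q"
  proof -
    have "(transport g h P P' f i, transport g h P P' f j) \<in> le2 Q'" if "(i, j) \<in> le1 P'" for i j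
    proof -
      have ij: "i \<in> verts P'" "j \<in> verts P'"
        using that sub(1) by auto
      then have "(f (k i), f (k j)) \<in> le2 Q"
        using \<open>f \<in> I_le P Q\<close> that by (simp add: I_le_def kk)
      then show ?thesis
        using ij in_P by (simp add: t hh2)
    qed
    with less show ?thesis by (simp add: I_le_def)
  qed
  have kg: "k (g i) = i" "g i \<in> verts P'" "f i \<in> verts Q" if "i \<in> verts P" for i
    using that gb fb by (auto simp: k_def bij_betw_inv_into_left dest: bij_betw_apply)
  show "dqp_isomorphism g (twist f P Q) (twist (transport g h P P' f) P' Q')"
    using gb g kg by (auto simp: dqp_isomorphism_def twist_def t hh1)
qed

lemma transport_inverse:
  assumes g: "dqp_isomorphism g P P'" and h: "dqp_isomorphism h Q Q'" and f: "f \<in> I_less P Q"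
  shows "transport (inv_into (verts P) g) (inv_into (verts Q) h) P' P (transport g h P P' f) = f"
proof -
  have gb: "bij_betw g (verts P) (verts P')" and hb: "bij_betw h (verts Q) (verts Q')"
    and fb: "f \<in> verts P \<rightarrow>\<^sub>E verts Q"
    using g h f by (auto simp: dqp_isomorphism_def I_less_def)
  have "inv_into (verts P') (inv_into (verts P) g) i = g i" if "i \<in> verts P" for i
    using that by (rule inv_into_inv_into_eq[OF gb])
  moreover have "f i \<in> verts Q" if "i \<in> verts P" for i
    using that fb by (rule PiE_mem[rotated])
  ultimately show ?thesis
    using fb bij_betw_inv_into_left[OF gb] bij_betw_inv_into_left[OF hb] bij_betw_apply[OF gb]
    by (intro ext) (auto simp: transport_def PiE_def extensional_def)
qed

lemma transport_inverse':
  assumes g: "dqp_isomorphism g P P'" and h: "dqp_isomorphism h Q Q'" and f: "f \<in> I_less P' Q'"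
  shows "transport g h P P' (transport (inv_into (verts P) g) (inv_into (verts Q) h) P' P f) = f"
proof -
  have gb: "bij_betw g (verts P) (verts P')" and hb: "bij_betw h (verts Q) (verts Q')"
    and fb: "f \<in> verts P' \<rightarrow>\<^sub>E verts Q'"
    using g h f by (auto simp: dqp_isomorphism_def I_less_def)
  have "inv_into (verts P) g i \<in> verts P" if "i \<in> verts P'" for i
    using that by (rule bij_betw_apply[OF bij_betw_inv_into[OF gb]])
  moreover have "f i \<in> verts Q'" if "i \<in> verts P'" for i
    using that fb by (rule PiE_mem[rotated])
  ultimately show ?thesis
    using fb bij_betw_inv_into_right[OF gb] bij_betw_inv_into_right[OF hb]
    by (intro ext) (auto simp: transport_def inv_into_inv_into_eq[OF gb] PiE_def extensional_def)
qed

lemma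
  fixes P P' Q Q' :: "nat dqp"
  assumes PP': "dqp_iso P P'" and QQ': "dqp_iso Q Q'"
  shows sum_I_less_cong: "(\<Sum>f\<in>I_less P Q. dqp_basis (twist f P Q) :: 'k::field hdqp) =
      (\<Sum>f\<in>I_less P' Q'. dqp_basis (twist f P' Q'))"
    and sum_I_le_cong: "(\<Sum>f\<in>I_le P Q. dqp_basis (twist f P Q) :: 'k::field hdqp) =
      (\<Sum>f\<in>I_le P' Q'. dqp_basis (twist f P' Q'))"
proof -
  obtain g h where g: "dqp_isomorphism g P P'" and h: "dqp_isomorphism h Q Q'"
    using PP' QQ' by (auto simp: dqp_iso_def)
  have d: "double_quasi_poset P" "double_quasi_poset P'" "double_quasi_poset Q" "double_quasi_poset Q'"
    using PP' QQ' by (auto simp: dqp_iso_def)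
  let ?g = "inv_into (verts P) g" and ?h = "inv_into (verts Q) h"
  note gi = dqp_isomorphism_inv[OF g] and hi = dqp_isomorphism_inv[OF h]
  have im: "f ` verts R \<subseteq> verts S" if "f \<in> I_less R S" for f and R S :: "nat dqp"
    using that by (auto simp: I_less_def)
  have "dqp_iso (twist f P Q) (twist (transport g h P P' f) P' Q')" if "f \<in> I_less P Q" for f
    unfolding dqp_iso_def
    using transport_twist[OF d g h that]
      double_quasi_poset_twist[OF d(1,3) im[OF that]]
      double_quasi_poset_twist[OF d(2,4) im[OF transport_I_less[OF d g h that]]]
    by blast
  then have eq: "(dqp_basis (twist (transport g h P P' f) P' Q') :: 'k hdqp) = dqp_basis (twist f P Q)"
    if "f \<in> I_less P Q" for f
    unfolding dqp_basis_def using that Quotient3_rel_abs[OF Quotient3_dqp_class] by metis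
  show "(\<Sum>f\<in>I_less P Q. dqp_basis (twist f P Q) :: 'k hdqp) =
      (\<Sum>f\<in>I_less P' Q'. dqp_basis (twist f P' Q'))"
    by (rule sum.reindex_bij_witness[where i = "transport ?g ?h P' P" and j = "transport g h P P'"])
      (simp_all add: transport_inverse[OF g h] transport_inverse'[OF g h] eq
        transport_I_less[OF d g h] transport_I_less[OF d(2,1,4,3) gi hi])
  have le: "f \<in> I_less R S" if "f \<in> I_le R S" for f and R S :: "nat dqp"
    using that by (simp add: I_le_def)
  show "(\<Sum>f\<in>I_le P Q. dqp_basis (twist f P Q) :: 'k hdqp) =
      (\<Sum>f\<in>I_le P' Q'. dqp_basis (twist f P' Q'))"
    by (rule sum.reindex_bij_witness[where i = "transport ?g ?h P' P" and j = "transport g h P P'"])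
      (simp_all add: transport_inverse[OF g h] transport_inverse'[OF g h] eq le
        transport_I_le[OF d g h] transport_I_le[OF d(2,1,4,3) gi hi])
qed

lift_definition class_lhd :: "dqp_class \<Rightarrow> dqp_class \<Rightarrow> 'k::field hdqp"
  is "\<lambda>P Q. \<Sum>f\<in>I_less P Q. dqp_basis (twist f P Q)"
  by (rule sum_I_less_cong)

lift_definition class_unlhd :: "dqp_class \<Rightarrow> dqp_class \<Rightarrow> 'k::field hdqp"
  is "\<lambda>P Q. \<Sum>f\<in>I_le P Q. dqp_basis (twist f P Q)"
  by (rule sum_I_le_cong)

definition hdqp_lhd :: "'k::field hdqp \<Rightarrow> 'k hdqp \<Rightarrow> 'k hdqp" (infixl \<open>\<lhd>\<close> 70) where
  "hdqp_lhd = bilinear_extension class_lhd"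

definition hdqp_unlhd :: "'k::field hdqp \<Rightarrow> 'k hdqp \<Rightarrow> 'k hdqp" (infixl \<open>\<unlhd>\<close> 70) where
  "hdqp_unlhd = bilinear_extension class_unlhd"

lemma bilinear_extension_basis:
  "bilinear_extension b (dqp_basis P) (dqp_basis Q) = b (abs_dqp_class P) (abs_dqp_class Q)"
  by (simp add: bilinear_extension_def dqp_basis_def) (rule poly_mapping_eqI, simp)

lemma dqp_basis_lhd:
  assumes "double_quasi_poset P" "double_quasi_poset Q"
  shows "(dqp_basis P \<lhd> dqp_basis Q :: 'k::field hdqp) = (\<Sum>f\<in>I_less P Q. dqp_basis (twist f P Q))"
  using assms by (simp add: hdqp_lhd_def bilinear_extension_basis class_lhd.abs_eq dqp_iso_refl)

lemma dqp_basis_unlhd: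
  assumes "double_quasi_poset P" "double_quasi_poset Q"
  shows "(dqp_basis P \<unlhd> dqp_basis Q :: 'k::field hdqp) = (\<Sum>f\<in>I_le P Q. dqp_basis (twist f P Q))"
  using assms by (simp add: hdqp_unlhd_def bilinear_extension_basis class_unlhd.abs_eq dqp_iso_refl)


section \<open>Packed words\<close>

definition packed_word :: "nat list \<Rightarrow> bool" where
  "packed_word w \<longleftrightarrow> (\<exists>r. set w = {1..r})"

text \<open>The map \<open>i \<mapsto> w\<^sub>i\<close>, with positions counted from 1.\<close>

definition letter :: "nat list \<Rightarrow> nat \<Rightarrow> nat" where
  "letter w i = w ! (i - 1)"

definition perm_words :: "nat \<Rightarrow> nat list set" where
  "perm_words n = {w. packed_word w \<and> length w = n \<and> distinct w}"

text \<open>Composition of words as maps: the \<open>i\<close>-th letter of \<open>word_comp v w\<close> is \<open>v (w i)\<close>.\<close>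

definition word_comp :: "nat list \<Rightarrow> nat list \<Rightarrow> nat list" (infixl \<open>\<circ>\<^sub>w\<close> 75) where
  "v \<circ>\<^sub>w w = map (letter v) w"

definition Comp :: "nat list \<Rightarrow> nat list set" where
  "Comp w = {\<sigma> \<in> perm_words (length w). \<forall>i\<in>{1..length w}. \<forall>j\<in>{1..length w}.
     letter w i < letter w j \<longrightarrow> letter \<sigma> i < letter \<sigma> j}"

definition word_dqp :: "nat list \<Rightarrow> nat dqp" where
  "word_dqp w =
     \<lparr>verts = {1..length w},
      le1 = {(i, j) \<in> {1..length w} \<times> {1..length w}. letter w i \<le> letter w j},
      le2 = {(i, j) \<in> {1..length w} \<times> {1..length w}. i \<le> j}\<rparr>"

lemma double_quasi_poset_word_dqp: "double_quasi_poset (word_dqp w)"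
  by (auto simp: double_quasi_poset_def word_dqp_def preorder_on_def refl_on_def trans_def)

lemma letter_word_comp: "i \<in> {1..length w} \<Longrightarrow> letter (v \<circ>\<^sub>w w) i = letter v (letter w i)"
  by (auto simp: letter_def word_comp_def)

lemma set_perm_word:
  assumes "w \<in> perm_words n"
  shows "set w = {1..n}"
proof -
  obtain r where "set w = {1..r}"
    using assms by (auto simp: perm_words_def packed_word_def)
  moreover have "card (set w) = n"
    using assms by (auto simp: perm_words_def distinct_card)
  ultimately show ?thesis by simp
qed

lemma finite_Comp: "finite (Comp w)"
proof (rule finite_subset)
  show "Comp w \<subseteq> {\<sigma>. set \<sigma> \<subseteq> {1..length w} \<and> length \<sigma> = length w}"
    using set_perm_word by (auto simp: Comp_def perm_words_def)
qed (rule finite_lists_length_eq, simp)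

end

theory Submission
  imports Defs
begin

text \<open>Both double quasi-posets live on \<open>{1..n}\<close> with the usual order as second
  preorder. Hence an element of \<open>I_less\<close> is a bijection f of \<open>{1..n}\<close> that
  is strictly increasing wherever the letters of u are: a compatible permutation of u, read as a
  function instead of a word (\<open>bij_betw_Comp_I_less\<close>). Twisting along \<sigma> pulls
  the comparison of letters of v back along \<sigma> and keeps the usual order, which yields the
  double quasi-poset of \<open>v \<circ>\<^sub>w \<sigma>\<close> (\<open>twist_word_dqp\<close>).
  Reindexing the sum gives the first identity.

  For the second, f in \<open>I_le\<close> must also respect ties. The usual order is antisymmetric,
  so f takes equal values at positions with equal letters, and injectivity rules out repeated
  letters. If u is a permutation, u itself is its only compatible permutation
  (\<open>Comp_perm_word\<close>), and it respects the weak comparisons too, so exactly one term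
  survives (\<open>I_le_word_dqp\<close>).\<close>

lemma letter_map_upt: "i \<in> {1..n} \<Longrightarrow> letter (map f [1..<Suc n]) i = f i"
  by (auto simp: letter_def simp del: upt_Suc)

lemma map_letter_upt: "map (letter w) [1..<Suc (length w)] = w"
  by (rule nth_equalityI) (auto simp: letter_def simp del: upt_Suc)

text \<open>Bridge between words and functions: distinctness is injectivity on positions, and
  counting letters forces the alphabet of a distinct packed word of length n to be
  \<open>{1..n}\<close>.\<close>

lemma perm_words_iff_bij_betw:
  "w \<in> perm_words n \<longleftrightarrow> length w = n \<and> bij_betw (letter w) {1..n} {1..n}"
proof -
  have "set w = letter w ` {1..n}" "distinct w \<longleftrightarrow> inj_on (letter w) {1..n}" if "length w = n"
  proof -
    have w: "w = map (letter w) [1..<Suc n]"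
      using map_letter_upt[of w] that by simp
    have upt: "set [1..<Suc n] = {1..n}"
      by auto
    show "set w = letter w ` {1..n}"
      by (subst w) (simp only: set_map upt)
    show "distinct w \<longleftrightarrow> inj_on (letter w) {1..n}"
      by (subst w) (simp only: distinct_map upt distinct_upt simp_thms)
  qed
  then show ?thesis
    using set_perm_word[of w n]
    by (auto simp: perm_words_def packed_word_def bij_betw_def)
qed

lemma map_upt_in_perm_words:
  assumes "bij_betw f {1..n} {1..n}"
  shows "map f [1..<Suc n] \<in> perm_words n"
proof -
  have "bij_betw (letter (map f [1..<Suc n])) {1..n} {1..n} = bij_betw f {1..n} {1..n}"
    by (rule bij_betw_cong) (rule letter_map_upt)
  then show ?thesis
    unfolding perm_words_iff_bij_betw using assms by simp
qed

lemma packed_word_in_perm_words: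
  "packed_word w \<Longrightarrow> length w = n \<Longrightarrow> inj_on (letter w) {1..n} \<Longrightarrow> w \<in> perm_words n"
  using map_letter_upt[of w] distinct_map[of "letter w" "[1..<Suc n]"]
  by (simp add: perm_words_def atLeastLessThanSuc_atLeastAtMost del: upt_Suc)

text \<open>Each value up to \<open>letter w i\<close> occurs at exactly one position, so a letter
  of a permutation is its rank. This recovers the word from the relative order of its
  letters.\<close>

lemma letter_perm_word_eq_card:
  assumes "w \<in> perm_words n" "i \<in> {1..n}"
  shows "letter w i = card {j \<in> {1..n}. letter w j \<le> letter w i}"
proof -
  have b: "bij_betw (letter w) {1..n} {1..n}"
    using assms by (simp add: perm_words_iff_bij_betw)
  have "letter w i \<in> {1..n}"
    using b assms(2) by (rule bij_betw_apply)
  then have "letter w ` {j \<in> {1..n}. letter w j \<le> letter w i} = {1..letter w i}"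
    using b by (fastforce simp: bij_betw_def)
  moreover have "inj_on (letter w) {j \<in> {1..n}. letter w j \<le> letter w i}"
    using b by (auto simp: bij_betw_def intro: inj_on_subset)
  ultimately show ?thesis
    by (metis card_image card_atLeastAtMost diff_Suc_1)
qed

text \<open>Without ties in u, compatibility fixes the relative order of all letters of \<sigma>,
  hence their ranks, hence \<sigma>.\<close>

lemma Comp_perm_word:
  assumes "u \<in> perm_words n"
  shows "Comp u = {u}"
proof -
  have len: "length u = n"
    using assms by (simp add: perm_words_def)
  have "\<sigma> = u" if "\<sigma> \<in> Comp u" for \<sigma>
  proof -
    have s: "\<sigma> \<in> perm_words n"
      and mono: "\<And>i j. i \<in> {1..n} \<Longrightarrow> j \<in> {1..n} \<Longrightarrow> letter u i < letter u j \<Longrightarrow> letter \<sigma> i < letter \<sigma> j"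
      using that len by (auto simp: Comp_def)
    have inj: "inj_on (letter u) {1..n}"
      using assms by (simp add: perm_words_iff_bij_betw bij_betw_def)
    \<comment> \<open>Compatibility applied to \<open>(i, j)\<close> and \<open>(j, i)\<close>
      settles distinct letters; equal letters force \<open>i = j\<close> by injectivity.\<close>
    have le: "letter u i \<le> letter u j \<longleftrightarrow> letter \<sigma> i \<le> letter \<sigma> j" if "i \<in> {1..n}" "j \<in> {1..n}" for i j
      using mono[OF that] mono[OF that(2,1)] inj_onD[OF inj _ that]
      by (metis order_le_less not_le)
    have "letter \<sigma> i = letter u i" if "i \<in> {1..n}" for i
    proof -
      have "{j \<in> {1..n}. letter \<sigma> j \<le> letter \<sigma> i} = {j \<in> {1..n}. letter u j \<le> letter u i}"
        using le that by blast
      then show ?thesis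
        using letter_perm_word_eq_card[OF s that] letter_perm_word_eq_card[OF assms that] by argo
    qed
    then have "map (letter \<sigma>) [1..<Suc n] = map (letter u) [1..<Suc n]"
      by (intro map_cong) auto
    moreover have "length \<sigma> = n"
      using s by (simp add: perm_words_def)
    ultimately show ?thesis
      using len by (metis map_letter_upt)
  qed
  moreover have "u \<in> Comp u"
    using assms len by (simp add: Comp_def)
  ultimately show ?thesis by blast
qed

lemma qless_le1_word_dqp:
  "qless (le1 (word_dqp w)) i j \<longleftrightarrow>
     i \<in> {1..length w} \<and> j \<in> {1..length w} \<and> letter w i < letter w j"
  by (auto simp: qless_def qeq_def word_dqp_def)

lemma qless_le2_word_dqp:
  "qless (le2 (word_dqp w)) i j \<longleftrightarrow> i \<in> {1..length w} \<and> j \<in> {1..length w} \<and> i < j"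
  by (auto simp: qless_def qeq_def word_dqp_def)

lemma verts_word_dqp [simp]: "verts (word_dqp w) = {1..length w}"
  by (simp add: word_dqp_def)

lemma I_less_word_dqp:
  assumes "length u = n" "length v = n"
  shows "f \<in> I_less (word_dqp u) (word_dqp v) \<longleftrightarrow>
     f \<in> extensional {1..n} \<and> bij_betw f {1..n} {1..n} \<and>
     (\<forall>i\<in>{1..n}. \<forall>j\<in>{1..n}. letter u i < letter u j \<longrightarrow> f i < f j)"
proof -
  \<comment> \<open>The range conditions in the function space and in
    \<open>qless_le2_word_dqp\<close> follow from bijectivity.\<close>
  have "f \<in> {1..n} \<rightarrow> {1..n}" if "bij_betw f {1..n} {1..n}"
    using bij_betw_apply[OF that] by blast
  then show ?thesis
    unfolding I_less_def qless_le1_word_dqp qless_le2_word_dqp PiE_def verts_word_dqp assms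
    by blast
qed

text \<open>The restriction is there because \<open>I_less\<close> consists of extensional
  functions; the inverse lists the values of f at 1, ..., n.\<close>

lemma bij_betw_Comp_I_less:
  assumes "length u = n" "length v = n"
  shows "bij_betw (\<lambda>\<sigma>. restrict (letter \<sigma>) {1..n}) (Comp u) (I_less (word_dqp u) (word_dqp v))"
proof (rule bij_betwI[where g = "\<lambda>f. map f [1..<Suc n]"])
  show "(\<lambda>\<sigma>. restrict (letter \<sigma>) {1..n}) \<in> Comp u \<rightarrow> I_less (word_dqp u) (word_dqp v)"
  proof
    fix \<sigma> assume "\<sigma> \<in> Comp u"
    moreover have "bij_betw (restrict (letter \<sigma>) {1..n}) {1..n} {1..n} = bij_betw (letter \<sigma>) {1..n} {1..n}"
      by (rule bij_betw_cong) simp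
    ultimately show "restrict (letter \<sigma>) {1..n} \<in> I_less (word_dqp u) (word_dqp v)"
      using assms(1) unfolding Comp_def I_less_word_dqp[OF assms] perm_words_iff_bij_betw
      by simp
  qed
  show "(\<lambda>f. map f [1..<Suc n]) \<in> I_less (word_dqp u) (word_dqp v) \<rightarrow> Comp u"
  proof
    fix f assume "f \<in> I_less (word_dqp u) (word_dqp v)"
    then have "bij_betw f {1..n} {1..n}"
      and "\<forall>i\<in>{1..n}. \<forall>j\<in>{1..n}. letter u i < letter u j \<longrightarrow> f i < f j"
      unfolding I_less_word_dqp[OF assms] by blast+
    then show "map f [1..<Suc n] \<in> Comp u"
      unfolding Comp_def assms(1) mem_Collect_eq
      by (metis map_upt_in_perm_words letter_map_upt)
  qed
  show "map (restrict (letter \<sigma>) {1..n}) [1..<Suc n] = \<sigma>" if "\<sigma> \<in> Comp u" for \<sigma>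
  proof -
    have "length \<sigma> = n"
      using that assms by (simp add: Comp_def perm_words_def)
    moreover have "map (restrict (letter \<sigma>) {1..n}) [1..<Suc n] = map (letter \<sigma>) [1..<Suc n]"
      by (rule map_cong) auto
    ultimately show ?thesis
      by (metis map_letter_upt)
  qed
  show "restrict (letter (map f [1..<Suc n])) {1..n} = f"
    if "f \<in> I_less (word_dqp u) (word_dqp v)" for f
  proof (rule extensionalityI)
    show "f \<in> extensional {1..n}"
      using that by (simp add: I_less_word_dqp[OF assms])
    show "restrict (letter (map f [1..<Suc n])) {1..n} i = f i" if "i \<in> {1..n}" for i
      using that by (simp only: restrict_apply' letter_map_upt)
  qed (rule restrict_extensional)
qed

lemma twist_word_dqp:
  assumes "length u = n" "length v = n" "\<sigma> \<in> perm_words n"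
  shows "twist (restrict (letter \<sigma>) {1..n}) (word_dqp u) (word_dqp v) = word_dqp (v \<circ>\<^sub>w \<sigma>)"
proof -
  have len: "length \<sigma> = n" "length (v \<circ>\<^sub>w \<sigma>) = n"
    using assms(3) by (simp_all add: perm_words_def word_comp_def)
  \<comment> \<open>Makes the range condition in \<open>le1 (word_dqp v)\<close> automatic, so only
    the comparison of letters remains.\<close>
  have "letter \<sigma> i \<in> {1..n}" if "i \<in> {1..n}" for i
    using assms(3) that by (auto simp: perm_words_iff_bij_betw simp del: atLeastAtMost_iff dest: bij_betw_apply)
  moreover have "letter (v \<circ>\<^sub>w \<sigma>) i = letter v (letter \<sigma> i)" if "i \<in> {1..n}" for i
    using letter_word_comp[of i \<sigma> v] that len by simp
  ultimately show ?thesis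
    using len assms(1,2)
    by (auto simp: twist_def word_dqp_def simp del: atLeastAtMost_iff)
qed

lemma I_le_word_dqp:
  assumes "packed_word u" "length u = n" "length v = n"
  shows "I_le (word_dqp u) (word_dqp v) =
    (if u \<in> perm_words n then {restrict (letter u) {1..n}} else {})"
proof (cases "u \<in> perm_words n")
  case True
  \<comment> \<open>The image of the singleton \<open>Comp u\<close>; it then remains to check the
    weak condition of \<open>I_le\<close> for this one map.\<close>
  have "I_less (word_dqp u) (word_dqp v) = {restrict (letter u) {1..n}}"
    using bij_betw_Comp_I_less[OF assms(2,3)] Comp_perm_word[OF True] by (simp add: bij_betw_def)
  moreover have "letter u i \<in> {1..n}" if "i \<in> {1..n}" for i
    using True that by (auto simp: perm_words_iff_bij_betw simp del: atLeastAtMost_iff dest: bij_betw_apply)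
  ultimately show ?thesis
    using True assms(2,3) by (auto simp: I_le_def word_dqp_def simp del: atLeastAtMost_iff)
next
  case False
  \<comment> \<open>A repeated letter gives distinct \<open>i \<sim>\<^sub>1 j\<close>, which \<open>f\<close> would have to identify, as \<open>\<le>\<^sub>2\<close> is antisymmetric.\<close>
  have "f \<notin> I_le (word_dqp u) (word_dqp v)" for f
  proof
    assume f: "f \<in> I_le (word_dqp u) (word_dqp v)"
    then have "bij_betw f {1..n} {1..n}"
      using I_less_word_dqp[OF assms(2,3)] by (simp add: I_le_def)
    then have injf: "inj_on f {1..n}"
      by (simp add: bij_betw_def)
    have "inj_on (letter u) {1..n}"
    proof (rule inj_onI)
      fix i j assume ij: "i \<in> {1..n}" "j \<in> {1..n}" "letter u i = letter u j"
      then have "(i, j) \<in> le1 (word_dqp u)" "(j, i) \<in> le1 (word_dqp u)"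
        using assms(2) by (simp_all add: word_dqp_def)
      then have "(f i, f j) \<in> le2 (word_dqp v)" "(f j, f i) \<in> le2 (word_dqp v)"
        using f by (simp_all add: I_le_def)
      then have "f i = f j"
        by (simp add: word_dqp_def)
      then show "i = j"
        using injf ij by (simp add: inj_on_eq_iff)
    qed
    with False assms show False
      by (simp add: packed_word_in_perm_words)
  qed
  with False show ?thesis by auto
qed

theorem proposition32:
  fixes u v :: "nat list" and n :: nat
  assumes "packed_word u" and "packed_word v"
    and "length u = n" and "length v = n"
  shows "(dqp_basis (word_dqp u) \<lhd> dqp_basis (word_dqp v) :: 'k::field hdqp) =
           (\<Sum>\<sigma>\<in>Comp u. dqp_basis (word_dqp (v \<circ>\<^sub>w \<sigma>))) \<and>
         (dqp_basis (word_dqp u) \<unlhd> dqp_basis (word_dqp v) :: 'k hdqp) =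
           (if u \<in> perm_words n then dqp_basis (word_dqp (v \<circ>\<^sub>w u)) else 0)"
proof
  have "(dqp_basis (word_dqp u) \<lhd> dqp_basis (word_dqp v) :: 'k hdqp) =
      (\<Sum>\<sigma>\<in>Comp u. dqp_basis (twist (restrict (letter \<sigma>) {1..n}) (word_dqp u) (word_dqp v)))"
    unfolding dqp_basis_lhd[OF double_quasi_poset_word_dqp double_quasi_poset_word_dqp]
    by (rule sum.reindex_bij_betw[OF bij_betw_Comp_I_less[OF assms(3,4)], symmetric])
  also have "\<dots> = (\<Sum>\<sigma>\<in>Comp u. dqp_basis (word_dqp (v \<circ>\<^sub>w \<sigma>)))"
    \<comment> \<open>Membership in \<open>Comp u\<close> supplies the hypothesis on \<sigma> in
      \<open>twist_word_dqp\<close>.\<close>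
    using assms(3) by (intro sum.cong refl arg_cong[of _ _ dqp_basis] twist_word_dqp[OF assms(3,4)])
      (simp add: Comp_def)
  finally show "(dqp_basis (word_dqp u) \<lhd> dqp_basis (word_dqp v) :: 'k hdqp) =
      (\<Sum>\<sigma>\<in>Comp u. dqp_basis (word_dqp (v \<circ>\<^sub>w \<sigma>)))" .
  show "(dqp_basis (word_dqp u) \<unlhd> dqp_basis (word_dqp v) :: 'k hdqp) =
      (if u \<in> perm_words n then dqp_basis (word_dqp (v \<circ>\<^sub>w u)) else 0)"
    \<comment> \<open>The sum now runs over a singleton or the empty set, which produces the two
      cases.\<close>
    unfolding dqp_basis_unlhd[OF double_quasi_poset_word_dqp double_quasi_poset_word_dqp]
      I_le_word_dqp[OF assms(1,3,4)]
    using twist_word_dqp[OF assms(3,4)] by simp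
qed

end
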